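(* Let $\Phi:\mathbb{R}^n\to\mathbb{R}\cup\{+\infty\}$ be proper, lower semicontinuous and convex with nonempty set of minimizers $X_*$. Consider sequences generated by the LOrA framework (defined in the context) applied to $\Phi$ with parameters $\sigma\in(0,1)$, $\lambda>0$ and $\{\delta_k\}$. Let $x_*\in X_*$ satisfy $R_0:=\|x_0-x_*\|=\min\{\|x_0-x\|:x\in X_*\}$, and let $\bar\delta_k:=k^{-1}\sum_{i=0}^{k-1}\delta_i$. Suppose that $\mathcal A_k=\infty$ at all iterations. Then for every $k\ge1$, $$\min_{1\le i\le k}\|y_i-x_{i-1}\|\le\frac{R_0}{\sqrt{1-\sigma}\sqrt k}+\sqrt{\frac{2\lambda\bar\delta_k}{1-\sigma}}.$$ Moreover, $$\min_{1\le i\le k}\Phi(y_i)-\Phi(x_* )\le\frac{R_0^2}{2\lambda k}+\bar\delta_k.$$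
   Context: LOrA framework for $\min_x\Phi(x)$. Input: $x_0\in\operatorname{dom}\Phi$, $\sigma\in(0,1)$, $\lambda>0$; set $y_0=x_0$. For $k=0,1,\dots$: 1. Choose $\delta_k>0$. 2. Find $y_{k+1}\in\operatorname{dom}\Phi$ and a proper closed $(1/\lambda)$-strongly convex function $\Gamma_k$ (on $\operatorname{dom}\Phi$) such that $\Gamma_k(\cdot)\le\Phi(\cdot)+\frac1{2\lambda}\|\cdot-x_k\|^2$ and $$\|\lambda\hat u_{k+1}\|^2+2\lambda\Big[\Phi(y_{k+1})+\frac1{2\lambda}\|y_{k+1}-x_k\|^2-\Gamma_k(x_{k+1})\Big]\le\sigma\|y_{k+1}-x_k\|^2+2\lambda\delta_k,$$ where, for some $\mathcal A_k\in(0,\infty]$, $x_{k+1}=\operatorname{argmin}_{x\in\mathbb{R}^n}\{\Gamma_k(x)+\frac1{2\mathcal A_k}\|x-x_k\|^2\}$ and $\hat u_{k+1}=\frac{x_k-x_{k+1}}{\mathcal A_k}$. When $\mathcal A_k=\infty$, $1/\mathcal A_k$ is read as $0$, so $x_{k+1}=\operatorname{argmin}\Gamma_k$ and $\hat u_{k+1}=0$. *)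

theory Defs
  imports "HOL-Analysis.Analysis"
begin

text \<open>
  Functions with values in the reals together with plus infinity are rendered as
  \<^typ>\<open>ereal\<close>-valued functions; properness excludes the value minus infinity.
\<close>

definition eff_dom :: "('a \<Rightarrow> ereal) \<Rightarrow> 'a set" where
  "eff_dom f = {x. f x < \<infinity>}"

definition proper_fun :: "('a \<Rightarrow> ereal) \<Rightarrow> bool" where
  "proper_fun f \<longleftrightarrow> (\<forall>x. f x \<noteq> -\<infinity>) \<and> eff_dom f \<noteq> {}"

definition lower_semicontinuous :: "('a::topological_space \<Rightarrow> ereal) \<Rightarrow> bool" where
  "lower_semicontinuous f \<longleftrightarrow> (\<forall>x. f x \<le> Liminf (at x) f)"

definition closed_fun :: "('a::topological_space \<Rightarrow> ereal) \<Rightarrow> bool" where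
  "closed_fun f \<longleftrightarrow> closed {(x, r::real). f x \<le> ereal r}"

definition convex_fun :: "('a::real_vector \<Rightarrow> ereal) \<Rightarrow> bool" where
  "convex_fun f \<longleftrightarrow>
     (\<forall>u v. \<forall>t::real. 0 < t \<and> t < 1 \<longrightarrow>
        f (t *\<^sub>R u + (1 - t) *\<^sub>R v) \<le> ereal t * f u + ereal (1 - t) * f v)"

definition strongly_convex_fun :: "real \<Rightarrow> ('a::real_normed_vector \<Rightarrow> ereal) \<Rightarrow> bool" where
  "strongly_convex_fun \<mu> f \<longleftrightarrow>
     (\<forall>u v. \<forall>t::real. 0 < t \<and> t < 1 \<longrightarrow>
        f (t *\<^sub>R u + (1 - t) *\<^sub>R v)
          \<le> ereal t * f u + ereal (1 - t) * f v - ereal (\<mu> / 2 * t * (1 - t) * (norm (u - v))\<^sup>2))"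

definition minimizers :: "('a \<Rightarrow> ereal) \<Rightarrow> 'a set" where
  "minimizers f = {x. is_arg_min f (\<lambda>_. True) x}"

text \<open>
  The step size \<open>a\<close> ranges over the extended interval from \<open>0\<close> (excluded) to infinity (included).
  Since \<open>1 / \<infinity> = 0\<close> in \<^typ>\<open>ereal\<close>, the two definitions below specialise, for \<open>a = \<infinity>\<close>,
  to the zero vector and to \<open>\<Gamma>\<close> itself.
\<close>

definition lora_residual :: "ereal \<Rightarrow> 'a::real_normed_vector \<Rightarrow> 'a \<Rightarrow> 'a" where
  "lora_residual a x x' = real_of_ereal (1 / a) *\<^sub>R (x - x')"

definition lora_objective ::
  "('a::real_normed_vector \<Rightarrow> ereal) \<Rightarrow> ereal \<Rightarrow> 'a \<Rightarrow> 'a \<Rightarrow> ereal" where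
  "lora_objective \<Gamma> a x z = \<Gamma> z + ereal (real_of_ereal (1 / a) / 2 * (norm (z - x))\<^sup>2)"

text \<open>
  One iteration, from \<open>x\<close> to the pair \<open>(y', x')\<close>.  The model \<open>\<Gamma>\<close> is extended-valued on the
  whole space and strongly convex there; this includes models given on \<open>eff_dom \<Phi>\<close> only, which
  are extended by infinity.  The value \<open>\<Gamma> x'\<close> is finite, being the value of a proper function at a
  minimizer of the regularised model, so the \<^typ>\<open>ereal\<close> difference below is a genuine one.
\<close>

definition lora_step ::
  "('a::real_normed_vector \<Rightarrow> ereal) \<Rightarrow> real \<Rightarrow> real \<Rightarrow> real \<Rightarrow> ereal \<Rightarrow> ('a \<Rightarrow> ereal)
    \<Rightarrow> 'a \<Rightarrow> 'a \<Rightarrow> 'a \<Rightarrow> bool" where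
  "lora_step \<Phi> \<sigma> lam d a \<Gamma> x y' x' \<longleftrightarrow>
     0 < d \<and> 0 < a \<and> y' \<in> eff_dom \<Phi> \<and>
     proper_fun \<Gamma> \<and> closed_fun \<Gamma> \<and> strongly_convex_fun (1 / lam) \<Gamma> \<and>
     (\<forall>z. \<Gamma> z \<le> \<Phi> z + ereal (1 / (2 * lam) * (norm (z - x))\<^sup>2)) \<and>
     is_arg_min (lora_objective \<Gamma> a x) (\<lambda>_. True) x' \<and>
     ereal ((norm (lam *\<^sub>R lora_residual a x x'))\<^sup>2)
       + ereal (2 * lam) * (\<Phi> y' + ereal (1 / (2 * lam) * (norm (y' - x))\<^sup>2) - \<Gamma> x')
       \<le> ereal (\<sigma> * (norm (y' - x))\<^sup>2 + 2 * lam * d)"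

definition lora_sequence ::
  "('a::real_normed_vector \<Rightarrow> ereal) \<Rightarrow> real \<Rightarrow> real \<Rightarrow> (nat \<Rightarrow> real) \<Rightarrow> (nat \<Rightarrow> ereal)
    \<Rightarrow> (nat \<Rightarrow> 'a \<Rightarrow> ereal) \<Rightarrow> (nat \<Rightarrow> 'a) \<Rightarrow> (nat \<Rightarrow> 'a) \<Rightarrow> bool" where
  "lora_sequence \<Phi> \<sigma> lam \<delta> A \<Gamma> x y \<longleftrightarrow>
     0 < \<sigma> \<and> \<sigma> < 1 \<and> 0 < lam \<and> x 0 \<in> eff_dom \<Phi> \<and> y 0 = x 0 \<and>
     (\<forall>k. lora_step \<Phi> \<sigma> lam (\<delta> k) (A k) (\<Gamma> k) (x k) (y (Suc k)) (x (Suc k)))"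

definition avg_delta :: "(nat \<Rightarrow> real) \<Rightarrow> nat \<Rightarrow> real" where
  "avg_delta \<delta> k = (\<Sum>i<k. \<delta> i) / real k"

end

theory Submission
  imports Defs
begin

text \<open>
  Since every \<open>A j\<close> is infinite, the point \<open>x (Suc j)\<close> minimises the strongly convex model \<open>\<Gamma> j\<close>
  itself, so the quadratic growth of \<open>\<Gamma> j\<close> around it, the upper bound on \<open>\<Gamma> j\<close> at the minimiser
  \<open>xs\<close>, and the relative error criterion combine into
  \[ 2\lambda(\Phi(y_{j+1}) - \Phi(x_*)) + (1-\sigma)\|y_{j+1}-x_j\|^2
     \le \|x_*-x_j\|^2 - \|x_*-x_{j+1}\|^2 + 2\lambda\delta_j. \]
  The right-hand side telescopes, so some index has a left-hand side at most the average of the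
  right-hand sides; both summands there are nonnegative, and each gives one of the two bounds.
\<close>

lemma minimizers_iff: "z \<in> minimizers f \<longleftrightarrow> (\<forall>w. f z \<le> f w)" for f :: "'a \<Rightarrow> ereal"
  by (auto simp: minimizers_def is_arg_min_def not_less)

lemma proper_fun_finite_at_minimizer:
  assumes "proper_fun f" "z \<in> minimizers f"
  shows "\<bar>f z\<bar> \<noteq> \<infinity>"
proof -
  obtain w where "f w < \<infinity>"
    using assms(1) by (auto simp: proper_fun_def eff_dom_def)
  moreover have "f z \<le> f w"
    using assms(2) by (simp add: minimizers_iff)
  ultimately show ?thesis
    using assms(1) by (auto simp: proper_fun_def)
qed

text \<open>Minimality of \<open>p\<close> bounds \<open>f p\<close> by the values of
  \<open>f\<close> on the segment from \<open>p\<close> to \<open>z\<close>. Strong convexity bounds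
  these in turn, and dividing by the weight \<open>t\<close> of \<open>z\<close> leaves the claim
  with the quadratic term scaled by \<open>1 - t\<close>. The full constant appears only in the
  limit as \<open>t\<close> decreases to 0.\<close>

lemma strongly_convex_fun_growth_at_minimizer:
  assumes sc: "strongly_convex_fun \<mu> f" and proper: "proper_fun f" and p: "p \<in> minimizers f"
  shows "f p + ereal (\<mu> / 2 * (norm (z - p))\<^sup>2) \<le> f z"
proof (cases "f z")
  case (real b)
  obtain a where a: "f p = ereal a"
    using proper_fun_finite_at_minimizer[OF proper p] by auto
  define q where "q = \<mu> / 2 * (norm (z - p))\<^sup>2"
  have bound: "a + (1 - t) * q \<le> b" if t: "0 < t" "t < 1" for t
  proof -
    have "f p \<le> f (t *\<^sub>R z + (1 - t) *\<^sub>R p)"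
      using p by (simp add: minimizers_iff)
    also have "\<dots> \<le> ereal t * f z + ereal (1 - t) * f p
        - ereal (\<mu> / 2 * t * (1 - t) * (norm (z - p))\<^sup>2)"
      using sc t by (simp add: strongly_convex_fun_def)
    finally have "a \<le> t * b + (1 - t) * a - t * ((1 - t) * q)"
      by (simp add: real a q_def mult_ac)
    then have "t * (a + (1 - t) * q) \<le> t * b"
      by (simp add: algebra_simps)
    with t show ?thesis by simp
  qed
  have "((\<lambda>t. a + (1 - t) * q) \<longlongrightarrow> a + (1 - 0) * q) (at_right 0)"
    by (intro tendsto_intros)
  moreover have "\<forall>\<^sub>F t in at_right 0. a + (1 - t) * q \<le> b"
    using eventually_at_right_real[OF zero_less_one] by eventually_elim (auto intro: bound)
  ultimately have "a + (1 - 0) * q \<le> b"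
    by (rule tendsto_upperbound) simp
  then show ?thesis
    by (simp add: real a q_def)
next
  case MInf
  then show ?thesis using proper by (simp add: proper_fun_def)
qed simp

lemma lora_step_descent:
  assumes step: "lora_step \<Phi> \<sigma> lam d \<infinity> \<Gamma> x y' x'"
    and lam: "0 < lam" and proper: "proper_fun \<Phi>" and xs: "xs \<in> minimizers \<Phi>"
  shows "2 * lam * (real_of_ereal (\<Phi> y') - real_of_ereal (\<Phi> xs)) + (1 - \<sigma>) * (norm (y' - x))\<^sup>2
    \<le> (norm (x - xs))\<^sup>2 - (norm (x' - xs))\<^sup>2 + 2 * lam * d"
proof -
  \<comment> \<open>Since \<open>1 / \<infinity> = 0\<close>, the proximal term disappears and
    \<open>x'\<close> minimises the model itself; for the same reason the residual is zero and drops
    out of the error criterion.\<close>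
  have "lora_objective \<Gamma> \<infinity> x = \<Gamma>"
    by (simp add: lora_objective_def fun_eq_iff flip: zero_ereal_def)
  then have y': "\<Phi> y' < \<infinity>" and proper\<Gamma>: "proper_fun \<Gamma>" and sc: "strongly_convex_fun (1 / lam) \<Gamma>"
    and upper: "\<Gamma> xs \<le> \<Phi> xs + ereal (1 / (2 * lam) * (norm (xs - x))\<^sup>2)"
    and min: "x' \<in> minimizers \<Gamma>"
    and crit: "ereal (2 * lam) * (\<Phi> y' + ereal (1 / (2 * lam) * (norm (y' - x))\<^sup>2) - \<Gamma> x')
       \<le> ereal (\<sigma> * (norm (y' - x))\<^sup>2 + 2 * lam * d)"
    using step
    by (auto simp: lora_step_def eff_dom_def lora_residual_def minimizers_def
        simp flip: zero_ereal_def)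
  obtain p where p: "\<Phi> y' = ereal p"
    using y' proper by (cases "\<Phi> y'") (auto simp: proper_fun_def)
  obtain s where s: "\<Phi> xs = ereal s"
    using proper_fun_finite_at_minimizer[OF proper xs] by auto
  obtain g where g: "\<Gamma> x' = ereal g"
    using proper_fun_finite_at_minimizer[OF proper\<Gamma> min] by auto
  have "\<Gamma> x' + ereal (1 / lam / 2 * (norm (xs - x'))\<^sup>2)
      \<le> \<Phi> xs + ereal (1 / (2 * lam) * (norm (xs - x))\<^sup>2)"
    using strongly_convex_fun_growth_at_minimizer[OF sc proper\<Gamma> min, of xs] upper
    by (rule order_trans)
  then have "g + (norm (x' - xs))\<^sup>2 / (2 * lam) \<le> s + (norm (x - xs))\<^sup>2 / (2 * lam)"
    by (simp add: g s norm_minus_commute mult.commute)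
  then have "2 * lam * (g + (norm (x' - xs))\<^sup>2 / (2 * lam))
      \<le> 2 * lam * (s + (norm (x - xs))\<^sup>2 / (2 * lam))"
    using lam by (intro mult_left_mono) simp_all
  then have "2 * lam * g + (norm (x' - xs))\<^sup>2 \<le> 2 * lam * s + (norm (x - xs))\<^sup>2"
    using lam by (simp add: distrib_left)
  \<comment> \<open>The unknown model value \<open>g\<close> enters here with the sign opposite to
    the previous estimate, so it cancels when the two are added.\<close>
  moreover have "2 * lam * (p - g) + (norm (y' - x))\<^sup>2 \<le> \<sigma> * (norm (y' - x))\<^sup>2 + 2 * lam * d"
    using crit lam by (simp add: p g distrib_left right_diff_distrib)
  ultimately show ?thesis
    by (simp add: p s algebra_simps)
qed

text \<open>If every term exceeded the average, so would their mean. Obtaining one index, rather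
  than a bound on a minimum, lets the same iterate serve both final estimates.\<close>

lemma exists_le_average:
  fixes f :: "nat \<Rightarrow> real"
  assumes "0 < k"
  shows "\<exists>j<k. f j \<le> (\<Sum>i<k. f i) / real k"
proof (rule ccontr)
  assume "\<not> ?thesis"
  then have "(\<Sum>i<k. (\<Sum>i<k. f i) / real k) < (\<Sum>i<k. f i)"
    using assms by (intro sum_strict_mono) (auto simp: not_le)
  with assms show False by simp
qed

theorem theorem4p4:
  fixes \<Phi> :: "real ^ 'n \<Rightarrow> ereal"
    and \<sigma> lam R\<^sub>0 :: real
    and \<delta> :: "nat \<Rightarrow> real"
    and A :: "nat \<Rightarrow> ereal"
    and \<Gamma> :: "nat \<Rightarrow> real ^ 'n \<Rightarrow> ereal"
    and x y :: "nat \<Rightarrow> real ^ 'n"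
    and xs :: "real ^ 'n"
    and k :: nat
  assumes "proper_fun \<Phi>" and "lower_semicontinuous \<Phi>" and "convex_fun \<Phi>"
    and "minimizers \<Phi> \<noteq> {}"
    and "lora_sequence \<Phi> \<sigma> lam \<delta> A \<Gamma> x y"
    and "is_arg_min (\<lambda>z. norm (x 0 - z)) (\<lambda>z. z \<in> minimizers \<Phi>) xs"
    and "R\<^sub>0 = norm (x 0 - xs)"
    and "\<And>j. A j = \<infinity>"
    and "k \<ge> 1"
  shows "(MIN i\<in>{1..k}. norm (y i - x (i - 1)))
           \<le> R\<^sub>0 / (sqrt (1 - \<sigma>) * sqrt (real k)) + sqrt (2 * lam * avg_delta \<delta> k / (1 - \<sigma>))
       \<and> (MIN i\<in>{1..k}. \<Phi> (y i)) - \<Phi> xs \<le> ereal (R\<^sub>0\<^sup>2 / (2 * lam * real k) + avg_delta \<delta> k)"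
proof -
  have \<sigma>: "\<sigma> < 1" and lam: "0 < lam"
    and step: "\<And>j. lora_step \<Phi> \<sigma> lam (\<delta> j) \<infinity> (\<Gamma> j) (x j) (y (Suc j)) (x (Suc j))"
    using assms(5,8) by (auto simp: lora_sequence_def)
  have xs: "xs \<in> minimizers \<Phi>"
    using assms(6) by (simp add: is_arg_min_def)
  have k: "0 < k" using assms(9) by simp
  define gap where "gap j = real_of_ereal (\<Phi> (y (Suc j))) - real_of_ereal (\<Phi> xs)" for j
  define r where "r j = norm (y (Suc j) - x j)" for j
  \<comment> \<open>\<open>C\<close> is the telescoped right-hand side divided by \<open>k\<close>,
    without its nonpositive last term.\<close>
  define C where "C = R\<^sub>0\<^sup>2 / real k + 2 * lam * avg_delta \<delta> k"
  obtain s where s: "\<Phi> xs = ereal s"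
    using proper_fun_finite_at_minimizer[OF assms(1) xs] by auto
  \<comment> \<open>The values are finite, so \<open>real_of_ereal\<close> in \<open>gap\<close>
    loses no information.\<close>
  have \<Phi>_y: "\<Phi> (y (Suc j)) = ereal (gap j + s)" for j
    using step[of j] assms(1)
    by (cases "\<Phi> (y (Suc j))")
      (auto simp: lora_step_def eff_dom_def proper_fun_def gap_def s)
  have gap_nonneg: "0 \<le> gap j" for j
  proof -
    have "\<Phi> xs \<le> \<Phi> (y (Suc j))"
      using xs by (simp add: minimizers_iff)
    then show ?thesis by (simp add: \<Phi>_y s)
  qed
  have "(\<Sum>j<k. 2 * lam * gap j + (1 - \<sigma>) * (r j)\<^sup>2)
      \<le> (\<Sum>j<k. (norm (x j - xs))\<^sup>2 - (norm (x (Suc j) - xs))\<^sup>2 + 2 * lam * \<delta> j)"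
    unfolding gap_def r_def
    by (intro sum_mono lora_step_descent[OF step lam assms(1) xs])
  also have "\<dots> = R\<^sub>0\<^sup>2 - (norm (x k - xs))\<^sup>2 + 2 * lam * (\<Sum>j<k. \<delta> j)"
    by (simp add: sum.distrib sum_lessThan_telescope'[where f = "\<lambda>j. (norm (x j - xs))\<^sup>2"] sum_distrib_left assms(7))
  \<comment> \<open>The term \<open>- (norm (x k - xs))\<^sup>2\<close> is discarded.\<close>
  also have "\<dots> \<le> real k * C"
    using k by (simp add: C_def avg_delta_def field_simps)
  finally have sum_le: "(\<Sum>j<k. 2 * lam * gap j + (1 - \<sigma>) * (r j)\<^sup>2) / real k \<le> C"
    using k by (simp add: field_simps)
  obtain j where j: "j < k" and "2 * lam * gap j + (1 - \<sigma>) * (r j)\<^sup>2 \<le> C"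
    using exists_le_average[OF k, of "\<lambda>j. 2 * lam * gap j + (1 - \<sigma>) * (r j)\<^sup>2"] sum_le by fastforce
  moreover have "0 \<le> 2 * lam * gap j" "0 \<le> (1 - \<sigma>) * (r j)\<^sup>2"
    using lam \<sigma> gap_nonneg[of j] by simp_all
  ultimately have gap_le: "2 * lam * gap j \<le> C" and r_le: "(1 - \<sigma>) * (r j)\<^sup>2 \<le> C"
    by linarith+
  \<comment> \<open>Positivity makes both summands under the root nonnegative, as the subadditivity
    of \<open>sqrt\<close> requires below.\<close>
  have "0 < \<delta> i" for i
    using step[of i] by (simp add: lora_step_def)
  then have avg_nonneg: "0 \<le> avg_delta \<delta> k"
    by (simp add: avg_delta_def sum_nonneg less_imp_le)
  have R0: "0 \<le> R\<^sub>0" by (simp add: assms(7))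
  have "(r j)\<^sup>2 \<le> C / (1 - \<sigma>)"
    using r_le \<sigma> by (simp add: field_simps)
  then have "r j \<le> sqrt (C / (1 - \<sigma>))"
    by (rule real_le_rsqrt)
  also have "C / (1 - \<sigma>) = R\<^sub>0\<^sup>2 / ((1 - \<sigma>) * real k) + 2 * lam * avg_delta \<delta> k / (1 - \<sigma>)"
    by (simp add: C_def add_divide_distrib mult.commute)
  also have "sqrt \<dots> \<le> sqrt (R\<^sub>0\<^sup>2 / ((1 - \<sigma>) * real k)) + sqrt (2 * lam * avg_delta \<delta> k / (1 - \<sigma>))"
    using \<sigma> lam avg_nonneg by (intro sqrt_add_le_add_sqrt) simp_all
  also have "sqrt (R\<^sub>0\<^sup>2 / ((1 - \<sigma>) * real k)) = R\<^sub>0 / (sqrt (1 - \<sigma>) * sqrt (real k))"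
    using R0 by (simp add: real_sqrt_divide real_sqrt_mult)
  finally have "r j \<le> R\<^sub>0 / (sqrt (1 - \<sigma>) * sqrt (real k)) + sqrt (2 * lam * avg_delta \<delta> k / (1 - \<sigma>))" .
  \<comment> \<open>The minimum starts at 1 while \<open>r\<close> is indexed from 0, so the witness
    is \<open>Suc j\<close>, which lies in \<open>{1..k}\<close> because
    \<open>j < k\<close>.\<close>
  moreover have "(MIN i\<in>{1..k}. norm (y i - x (i - 1))) \<le> r j"
    using j by (intro Min_le) (auto simp: r_def intro!: image_eqI[of _ _ "Suc j"])
  moreover have "(MIN i\<in>{1..k}. \<Phi> (y i)) - \<Phi> xs \<le> \<Phi> (y (Suc j)) - \<Phi> xs"
    using j by (intro ereal_minus_mono Min_le) auto
  moreover have "gap j \<le> C / (2 * lam)"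
    using gap_le lam by (simp add: field_simps)
  then have "\<Phi> (y (Suc j)) - \<Phi> xs \<le> ereal (R\<^sub>0\<^sup>2 / (2 * lam * real k) + avg_delta \<delta> k)"
    using lam by (simp add: \<Phi>_y s C_def add_divide_distrib mult_ac)
  ultimately show ?thesis
    by (meson order_trans)
qed

end
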